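(* Let $E$ be a compact subset of $\mathbb{R}^d$ for which there are a number $k>0$ (not necessarily an integer) and a constant $C_E$ such that $N_E(\delta)\le \max(C_E\delta^{-k},1)$ for all $\delta>0$, and let $P_n$ be a point set in $\mathbb{R}^d$ of size $n$. Then, for $s>k$, $$|P_n\cap E|\le \left(1+C_E^{\frac sk}\left(\frac sk-1\right)I_s(P_n)\right)^{\frac{1}{\frac sk+1}} n^{\frac{2}{\frac sk+1}}.$$ Moreover, the exponent $\frac{2}{1+\frac sk}$ is, in general, best possible.
   Context: Here $d\ge 2$. A point set of size $n$ is a finite set with exactly $n$ elements; $|S|$ denotes the number of elements of a finite set $S$, and $|x|$ denotes the Euclidean norm of $x\in\mathbb{R}^d$. For a point set $P_n$ of size $n$, the discrete $s$-energy is $$I_s(P_n)=n^{-2}\sum_{p\ne p';\ p,p'\in P_n}|p-p'|^{-s},$$ where the sum is over pairs $(p,p')$ with $p,p'\in P_n$ and $p\neq p'$. For a compact set $E\subset\mathbb{R}^d$ and $\delta>0$, $N_E(\delta)$ is the minimal number of closed balls of radius $\delta$ needed to cover $E$. The constant $C_E$ depends on $E$ and also on $k$.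
   Formalization: The displayed bound is proved with 2^k C_E in place of C_E, since as stated (balls of radius δ) it fails for two points at distance 1 with k=2, s=4, C_E=1/2; C_E ≥ 0 is assumed, and sharpness of the exponent is shown for every 0<k≤d and s>k. *)

theory Defs
  imports "HOL-Analysis.Analysis"
begin

definition s_energy :: "real \<Rightarrow> 'a::real_normed_vector set \<Rightarrow> real" where
  "s_energy s P =
     (\<Sum>(p, q) \<in> {(p, q). p \<in> P \<and> q \<in> P \<and> p \<noteq> q}. norm (p - q) powr (- s)) / (real (card P))\<^sup>2"

(* The centres need not lie in E. Two points of one ball of radius \<delta> may be 2 * \<delta> apart, so an
   estimate for pairs at distance at most \<delta> uses balls of radius \<delta> / 2: a bound C * \<delta> powr (- k)
   on the covering number enters it as (2 powr k * C) * \<delta> powr (- k). *)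
definition covering_number :: "'a::metric_space set \<Rightarrow> real \<Rightarrow> nat" where
  "covering_number E \<delta> = (LEAST N. \<exists>X. finite X \<and> card X = N \<and> E \<subseteq> (\<Union>x\<in>X. cball x \<delta>))"

end

theory Submission
  imports Defs "HOL-Real_Asymp.Real_Asymp"
begin

text \<open>
  Upper bound. Let \<open>m\<close> points of the set be given. Placing them into \<open>covering_number E (\<delta> / 2)\<close> balls and
  applying Cauchy--Schwarz, at least \<open>m\<^sup>2 / covering_number E (\<delta> / 2)\<close> ordered pairs (the diagonal
  included) are at distance at most \<open>\<delta>\<close>. In terms of \<open>u = \<bar>p - q\<bar>\<^sup>k / D\<close>, with \<open>D = 2\<^sup>k C\<close>, this says that
  at least \<open>m\<^sup>2 t - m\<close> off-diagonal pairs satisfy \<open>u \<le> t\<close>, for each \<open>t \<le> 1\<close>. Integrating against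
  \<open>a t powr (- a - 1)\<close> over \<open>[1/m, 1]\<close>, where \<open>a = s / k\<close>, gives exactly
  \<open>m powr (a + 1) - m\<^sup>2 \<le> (a - 1) (\<Sum>u powr (- a))\<close>.

  Sharpness. Take a Cantor dust whose points are coordinatewise subset sums of the gaps
  \<open>r ^ i / (i + 1)\<close>, with \<open>r = 2 powr (- d / k) \<le> 1 / 2\<close>. The factor \<open>1 / (i + 1)\<close> keeps different digit
  strings apart even for \<open>k = d\<close>; it costs only a polynomial in the level \<open>L\<close>, whereas level \<open>L\<close> has
  \<open>X = 2 ^ (L d)\<close> points, and so it is absorbed by the slack in the exponent \<open>\<beta>\<close>. The energy sum of level
  \<open>L\<close> is at most \<open>X powr (1 + s / k)\<close> times this polynomial; with enough far-away points added, the
  energy is at most 2.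
\<close>

subsection \<open>The upper bound\<close>

text \<open>Total boundedness supplies some finite cover, so the \<open>LEAST\<close> in
  \<open>covering_number\<close> is attained and yields an actual family of balls.\<close>

lemma covering_number_witness:
  fixes E :: "'a::metric_space set"
  assumes "compact E" "\<delta> > 0"
  obtains X where "finite X" "card X = covering_number E \<delta>" "E \<subseteq> (\<Union>x\<in>X. cball x \<delta>)"
proof -
  obtain K where K: "finite K" "E \<subseteq> (\<Union>x\<in>K. ball x \<delta>)"
    using compact_imp_seq_compact[OF assms(1)] seq_compact_imp_totally_bounded assms(2) by metis
  have "\<exists>X. finite X \<and> card X = card K \<and> E \<subseteq> (\<Union>x\<in>X. cball x \<delta>)"
  proof (intro exI[of _ K] conjI)
    show "E \<subseteq> (\<Union>x\<in>K. cball x \<delta>)"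
      using K(2) by (rule subset_trans) (intro UN_mono ball_subset_cball order_refl)
  qed (use K in auto)
  then have "\<exists>X. finite X \<and> card X = covering_number E \<delta> \<and> E \<subseteq> (\<Union>x\<in>X. cball x \<delta>)"
    unfolding covering_number_def by (rule LeastI)
  then show ?thesis using that by blast
qed

lemma covering_number_le:
  assumes "finite X" "E \<subseteq> (\<Union>x\<in>X. cball x \<delta>)"
  shows "covering_number E \<delta> \<le> card X"
  unfolding covering_number_def using assms by (intro Least_le) blast

section \<open>Counting close pairs by Cauchy-Schwarz\<close>

text \<open>Cauchy-Schwarz for the fibre sizes \<open>h x\<close> of a colouring \<open>f\<close>:
  they add up to \<open>card Q\<close>, and their squares add up to the number of equally coloured
  ordered pairs, diagonal included.\<close>

lemma card_squared_le_monochromatic_pairs: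
  assumes "finite Q" "finite X" "f ` Q \<subseteq> X"
  shows "(card Q)\<^sup>2 \<le> card X * card {(p, q). p \<in> Q \<and> q \<in> Q \<and> f p = f q}"
proof -
  define h where "h x = card {p \<in> Q. f p = x}" for x
  have cQ: "card Q = (\<Sum>x\<in>X. h x)"
  proof -
    have "card Q = card (\<Union>x\<in>X. {p \<in> Q. f p = x})"
      using assms by (intro arg_cong[where f=card]) auto
    also have "\<dots> = (\<Sum>x\<in>X. h x)"
      unfolding h_def using assms by (intro card_UN_disjoint) auto
    finally show ?thesis .
  qed
  have "card {(p, q). p \<in> Q \<and> q \<in> Q \<and> f p = f q}
      = card (\<Union>x\<in>X. {p \<in> Q. f p = x} \<times> {p \<in> Q. f p = x})"
    using assms by (intro arg_cong[where f=card]) auto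
  also have "\<dots> = (\<Sum>x\<in>X. card ({p \<in> Q. f p = x} \<times> {p \<in> Q. f p = x}))"
    using assms by (intro card_UN_disjoint) auto
  also have "\<dots> = (\<Sum>x\<in>X. (h x)\<^sup>2)"
    by (simp add: h_def power2_eq_square card_cartesian_product)
  finally have *: "card {(p, q). p \<in> Q \<and> q \<in> Q \<and> f p = f q} = (\<Sum>x\<in>X. (h x)\<^sup>2)" .
  have "(\<Sum>x\<in>X. real (h x))\<^sup>2 \<le> real (card X) * (\<Sum>x\<in>X. (real (h x))\<^sup>2)"
    using Cauchy_Schwarz_ineq_sum[of "\<lambda>_. 1::real" "\<lambda>x. real (h x)" X] by simp
  then have "real ((card Q)\<^sup>2) \<le> real (card X * card {(p, q). p \<in> Q \<and> q \<in> Q \<and> f p = f q})"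
    unfolding * cQ by simp
  then show ?thesis by (simp only: of_nat_le_iff)
qed

text \<open>Colour each point by the centre of one ball of radius \<open>\<delta> / 2\<close>
  containing it; points of equal colour are within \<open>\<delta>\<close> by the triangle
  inequality.\<close>

lemma card_squared_le_close_pairs:
  fixes E :: "'a::metric_space set"
  assumes "compact E" "finite Q" "Q \<subseteq> E" "\<delta> > 0"
  shows "(card Q)\<^sup>2 \<le> covering_number E (\<delta> / 2) * card {(p, q). p \<in> Q \<and> q \<in> Q \<and> dist p q \<le> \<delta>}"
proof -
  obtain X where X: "finite X" "card X = covering_number E (\<delta> / 2)" "E \<subseteq> (\<Union>x\<in>X. cball x (\<delta> / 2))"
    using covering_number_witness[OF assms(1), of "\<delta> / 2"] assms(4) by auto
  then have "\<forall>p\<in>Q. \<exists>x\<in>X. dist x p \<le> \<delta> / 2"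
    using assms(3) by fastforce
  then obtain f where f: "\<And>p. p \<in> Q \<Longrightarrow> f p \<in> X \<and> dist (f p) p \<le> \<delta> / 2"
    by metis
  have "(card Q)\<^sup>2 \<le> card X * card {(p, q). p \<in> Q \<and> q \<in> Q \<and> f p = f q}"
    using assms X f by (intro card_squared_le_monochromatic_pairs) auto
  also have "\<dots> \<le> card X * card {(p, q). p \<in> Q \<and> q \<in> Q \<and> dist p q \<le> \<delta>}"
  proof (intro mult_left_mono card_mono)
    show "finite {(p, q). p \<in> Q \<and> q \<in> Q \<and> dist p q \<le> \<delta>}"
      by (rule finite_subset[of _ "Q \<times> Q"]) (use assms in auto)
    show "{(p, q). p \<in> Q \<and> q \<in> Q \<and> f p = f q} \<subseteq> {(p, q). p \<in> Q \<and> q \<in> Q \<and> dist p q \<le> \<delta>}"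
    proof clarify
      fix p q assume "p \<in> Q" "q \<in> Q" "f p = f q"
      then have "dist (f p) p \<le> \<delta> / 2" "dist (f p) q \<le> \<delta> / 2"
        using f by metis+
      then show "dist p q \<le> \<delta>"
        using dist_triangle3[of p q "f p"] by linarith
    qed
  qed auto
  finally show ?thesis using X by simp
qed

section \<open>From pair counts to power sums by integration\<close>

text \<open>Layer-cake formula for one term. The lower limit \<open>c\<close> is kept apart from
  \<open>u\<close> so that the formulas for different \<open>u\<close> can be added over one common
  interval.\<close>

lemma has_integral_layer:
  fixes a c u :: real
  assumes "a > 0" "0 < c" "c \<le> u" "u \<le> 1"
  shows "((\<lambda>t. if u \<le> t then a * t powr (- a - 1) else 0) has_integral (u powr (- a) - 1)) {c..1}"
proof -
  have "((\<lambda>t. a * t powr (- a - 1)) has_integral (- (1 powr (- a)) - (- (u powr (- a))))) {u..1}"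
    using assms
    by (intro fundamental_theorem_of_calculus)
      (auto simp: has_real_derivative_iff_has_vector_derivative[symmetric] intro!: derivative_eq_intros)
  then have "((\<lambda>t. a * t powr (- a - 1)) has_integral (u powr (- a) - 1)) {u..1}"
    by simp
  then have "((\<lambda>t. if t \<in> {u..1} then a * t powr (- a - 1) else 0) has_integral (u powr (- a) - 1)) {c..1}"
    using assms by (subst has_integral_restrict) auto
  then show ?thesis
    by (rule has_integral_eq[rotated]) auto
qed

text \<open>\<open>V\<close> stands for the ordered off-diagonal pairs of \<open>m\<close> points
  and \<open>u\<close> for their rescaled distances. The lower bound on the counting function is
  integrated against the weight \<open>a * t powr (- a - 1)\<close>, which turns counts into the sum
  of \<open>u powr (- a)\<close>.\<close>

lemma sum_powr_ge_of_counting_bound: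
  fixes u :: "'b \<Rightarrow> real" and a :: real and m :: nat
  assumes V: "finite V" "card V + m = m\<^sup>2"
    and u: "\<And>v. v \<in> V \<Longrightarrow> u v > 0"
    and count: "\<And>t. 0 < t \<Longrightarrow> t \<le> 1 \<Longrightarrow> (real m)\<^sup>2 * t - real m \<le> real (card {v \<in> V. u v \<le> t})"
    and a: "a > 1" and m: "m > 0"
  shows "real m powr (a + 1) - (real m)\<^sup>2 \<le> (a - 1) * (\<Sum>v\<in>V. u v powr (- a))"
proof -
  \<comment> \<open>At \<open>t = 1\<close> the counting bound is \<open>m\<^sup>2 - m\<close>, the
    size of all of \<open>V\<close>.\<close>
  have u1: "u v \<le> 1" if "v \<in> V" for v
  proof -
    have "real (card V) \<le> real (card {v \<in> V. u v \<le> 1})"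
      using count[of 1] V(2) by (simp add: algebra_simps flip: of_nat_power of_nat_add V(2))
    then have "{v \<in> V. u v \<le> 1} = V"
      using V(1) by (intro card_seteq) auto
    then show ?thesis using that by blast
  qed
  \<comment> \<open>The bound \<open>m\<^sup>2 t - m\<close> is nonpositive up to
    \<open>1 / m\<close>, so integration starts there.\<close>
  define c where "c = 1 / real m"
  have c: "0 < c" "c \<le> 1" using m by (auto simp: c_def)
  \<comment> \<open>Truncation puts all values into \<open>{c..1}\<close>. It leaves the counts for
    \<open>t\<close> in that interval unchanged and can only lower the sum of negative
    powers.\<close>
  define w where "w v = max (u v) c" for v
  have w: "c \<le> w v" "w v \<le> 1" if "v \<in> V" for v
    using u1[OF that] c by (auto simp: w_def)
  have I1: "((\<lambda>t. \<Sum>v\<in>V. if w v \<le> t then a * t powr (- a - 1) else 0)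
      has_integral (\<Sum>v\<in>V. w v powr (- a) - 1)) {c..1}"
    using V a c w by (intro has_integral_sum has_integral_layer) auto
  \<comment> \<open>An antiderivative of the weight times the counting bound.\<close>
  define G where "G t = - (a * (real m)\<^sup>2 / (a - 1)) * t powr (1 - a) + real m * t powr (- a)" for t
  have I2: "((\<lambda>t. a * t powr (- a - 1) * ((real m)\<^sup>2 * t - real m)) has_integral (G 1 - G c)) {c..1}"
  proof (rule fundamental_theorem_of_calculus)
    fix t assume t: "t \<in> {c..1}"
    then have t0: "t > 0" using c by auto
    have "(G has_real_derivative
        - (a * (real m)\<^sup>2 / (a - 1)) * ((1 - a) * t powr (1 - a - 1)) + real m * (- a * t powr (- a - 1))) (at t)"
      unfolding G_def using t0 a by (auto intro!: derivative_eq_intros)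
    also have "- (a * (real m)\<^sup>2 / (a - 1)) * ((1 - a) * t powr (1 - a - 1)) = a * (real m)\<^sup>2 * t powr (- a)"
      using a by (simp add: field_simps)
    also have "t powr (- a) = t powr (- a - 1) * t"
      using t0 by (simp add: powr_diff)
    also have "a * (real m)\<^sup>2 * (t powr (- a - 1) * t) + real m * (- a * t powr (- a - 1))
        = a * t powr (- a - 1) * ((real m)\<^sup>2 * t - real m)"
      by (simp add: algebra_simps)
    finally show "(G has_vector_derivative a * t powr (- a - 1) * ((real m)\<^sup>2 * t - real m)) (at t within {c..1})"
      by (auto simp: has_real_derivative_iff_has_vector_derivative[symmetric] intro: DERIV_subset)
  qed (use c in auto)
  have "G 1 - G c \<le> (\<Sum>v\<in>V. w v powr (- a) - 1)"
  proof (rule has_integral_le[OF I2 I1])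
    fix t assume t: "t \<in> {c..1}"
    then have t0: "t > 0" using c by auto
    have "(\<Sum>v\<in>V. if w v \<le> t then a * t powr (- a - 1) else 0)
        = a * t powr (- a - 1) * real (card {v \<in> V. w v \<le> t})"
      using V by (simp add: sum.If_cases Int_def)
    also have "{v \<in> V. w v \<le> t} = {v \<in> V. u v \<le> t}"
      using t by (auto simp: w_def)
    finally show "a * t powr (- a - 1) * ((real m)\<^sup>2 * t - real m)
        \<le> (\<Sum>v\<in>V. if w v \<le> t then a * t powr (- a - 1) else 0)"
      using count[of t] t t0 a by (auto intro!: mult_left_mono)
  qed
  also have "\<dots> \<le> (\<Sum>v\<in>V. u v powr (- a) - 1)"
    using u a by (intro sum_mono diff_right_mono powr_mono2') (auto simp: w_def)
  also have "\<dots> = (\<Sum>v\<in>V. u v powr (- a)) - real (card V)"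
    by (simp add: sum_subtractf)
  finally have S: "G 1 - G c + real (card V) \<le> (\<Sum>v\<in>V. u v powr (- a))" by simp
  have cV: "real (card V) = (real m)\<^sup>2 - real m"
    by (simp add: V(2)[symmetric] flip: of_nat_power)
  have p: "c powr (- a) = real m powr a" "c powr (1 - a) = real m powr (a - 1)"
    using m by (simp_all add: c_def powr_minus_divide powr_divide flip: powr_minus)
      (simp_all add: powr_diff powr_minus field_simps)
  have q: "(real m)\<^sup>2 * real m powr (a - 1) = real m powr (a + 1)" "real m * real m powr a = real m powr (a + 1)"
    using m by (simp_all add: powr_add powr_diff power2_eq_square)
  \<comment> \<open>The \<open>- 1\<close> in each layer formula adds up to
    \<open>card V = m\<^sup>2 - m\<close>. The terms linear in \<open>m\<close> cancel, and
    \<open>a - (a - 1) = 1\<close> copies of \<open>m powr (a + 1)\<close> remain.\<close>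
  have "(a - 1) * (G 1 - G c + real (card V)) = real m powr (a + 1) - (real m)\<^sup>2"
  proof -
    have "(a - 1) * (G 1 - G c + real (card V))
       = - a * (real m)\<^sup>2 + (a - 1) * real m
         + a * ((real m)\<^sup>2 * real m powr (a - 1)) - (a - 1) * (real m * real m powr a)
         + (a - 1) * ((real m)\<^sup>2 - real m)"
    proof -
      define B where "B = a * (real m)\<^sup>2 / (a - 1)"
      have 1: "a * (real m)\<^sup>2 = (a - 1) * B" using a by (simp add: B_def)
      then have 2: "a * ((real m)\<^sup>2 * real m powr (a - 1)) = (a - 1) * B * real m powr (a - 1)"
        by (simp flip: mult.assoc)
      show ?thesis
        unfolding G_def cV p B_def[symmetric] using 1 2 by (simp add: algebra_simps)
    qed
    then show ?thesis unfolding q by (simp add: algebra_simps)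
  qed
  then show ?thesis
    using mult_left_mono[OF S, of "a - 1"] a by simp
qed

text \<open>Rescaling makes the covering bound uniform: with \<open>D = 2 powr k * C\<close> and
  \<open>u\<close> the \<open>k\<close>-th power of the distance over \<open>D\<close>, the
  close-pair count becomes the hypothesis of \<open>sum_powr_ge_of_counting_bound\<close>, and
  \<open>u powr (- s / k)\<close> is \<open>D powr (s / k)\<close> times an energy term.\<close>

lemma energy_sum_ge:
  fixes E :: "'a::real_normed_vector set"
  assumes E: "compact E" "0 < k" "0 \<le> C"
    and cov: "\<And>\<delta>. \<delta> > 0 \<Longrightarrow> real (covering_number E \<delta>) \<le> max (C * \<delta> powr (- k)) 1"
    and Q: "finite Q" "Q \<subseteq> E" and s: "k < s"
  shows "real (card Q) powr (s / k + 1) - (real (card Q))\<^sup>2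
    \<le> (2 powr k * C) powr (s / k) * (s / k - 1)
      * (\<Sum>(p, q) \<in> {(p, q). p \<in> Q \<and> q \<in> Q \<and> p \<noteq> q}. norm (p - q) powr (- s))"
proof -
  define V where "V = {(p, q). p \<in> Q \<and> q \<in> Q \<and> p \<noteq> q}"
  define m where "m = card Q"
  define a where "a = s / k"
  define D where "D = 2 powr k * C"
  have a: "a > 1" using E s by (simp add: a_def)
  have finV: "finite V"
    by (rule finite_subset[of _ "Q \<times> Q"]) (use Q in \<open>auto simp: V_def\<close>)
  have cV: "card V + m = m\<^sup>2"
  proof -
    have "V \<union> (\<lambda>p. (p, p)) ` Q = Q \<times> Q" "V \<inter> (\<lambda>p. (p, p)) ` Q = {}"
      by (auto simp: V_def)
    then have "card (Q \<times> Q) = card V + card ((\<lambda>p. (p, p)) ` Q)"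
      using card_Un_disjoint[OF finV, of "(\<lambda>p. (p, p)) ` Q"] Q by simp
    then show ?thesis
      by (simp add: m_def card_image inj_on_def power2_eq_square card_cartesian_product)
  qed
  \<comment> \<open>The summand \<open>m\<close> accounts for the diagonal pairs; passing from
    \<open>C\<close> to \<open>D\<close> pays for halving the radius.\<close>
  have close: "(real m)\<^sup>2 \<le> max (D * \<delta> powr (- k)) 1 * (real m + real (card {v \<in> V. norm (fst v - snd v) \<le> \<delta>}))"
    if d: "\<delta> > 0" for \<delta>
  proof -
    let ?W = "{v \<in> V. norm (fst v - snd v) \<le> \<delta>}"
    have eq: "{(p, q). p \<in> Q \<and> q \<in> Q \<and> dist p q \<le> \<delta>} = (\<lambda>p. (p, p)) ` Q \<union> ?W"
      using d by (auto simp: V_def dist_norm image_iff)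
    have "card {(p, q). p \<in> Q \<and> q \<in> Q \<and> dist p q \<le> \<delta>} \<le> m + card ?W"
      unfolding eq m_def by (metis (no_types, lifting) Q(1) add_mono card_Un_le card_image_le le_trans order_refl)
    then have "m\<^sup>2 \<le> covering_number E (\<delta> / 2) * (m + card ?W)"
      using card_squared_le_close_pairs[OF E(1) Q d] unfolding m_def
      by (meson le_trans mult_le_mono2)
    then have "real (m\<^sup>2) \<le> real (covering_number E (\<delta> / 2) * (m + card ?W))"
      by (simp only: of_nat_le_iff)
    then have "(real m)\<^sup>2 \<le> real (covering_number E (\<delta> / 2)) * (real m + real (card ?W))"
      by simp
    also have "\<dots> \<le> max (C * (\<delta> / 2) powr (- k)) 1 * (real m + real (card ?W))"
      using cov[of "\<delta> / 2"] d by (intro mult_right_mono) auto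
    also have "C * (\<delta> / 2) powr (- k) = D * \<delta> powr (- k)"
      using d by (simp add: D_def powr_divide powr_minus field_simps)
    finally show ?thesis .
  qed
  have S0: "0 \<le> (\<Sum>v\<in>V. norm (fst v - snd v) powr (- s))"
    by (intro sum_nonneg) auto
  have "real m powr (a + 1) - (real m)\<^sup>2 \<le> D powr a * (a - 1) * (\<Sum>v\<in>V. norm (fst v - snd v) powr (- s))"
  proof (cases "m = 0")
    case True
    then show ?thesis using S0 a by simp
  next
    case m: False
    show ?thesis
    \<comment> \<open>Division by \<open>D\<close> fails here. But then one ball suffices at every
      scale, so there is a single point and the left side is \<open>1 - 1\<close>.\<close>
    proof (cases "C = 0")
      case True
      have "V = {}"
      proof (rule ccontr)
        assume "V \<noteq> {}"
        then obtain v where v: "v \<in> V" by blast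
        \<comment> \<open>At half the distance of a given pair, all pairs, this one included, would
          have to be close.\<close>
        define \<delta> where "\<delta> = norm (fst v - snd v) / 2"
        have d: "\<delta> > 0" using v by (auto simp: \<delta>_def V_def)
        have "real (card V + m) \<le> real (m + card {v \<in> V. norm (fst v - snd v) \<le> \<delta>})"
          using close[OF d] True unfolding cV by (simp add: D_def)
        then have "{v \<in> V. norm (fst v - snd v) \<le> \<delta>} = V"
          using finV by (intro card_seteq) auto
        then have "norm (fst v - snd v) \<le> \<delta>" using v by blast
        then show False using d by (simp add: \<delta>_def)
      qed
      then have "m = m\<^sup>2" using cV by simp
      then have "m = 1" using m by (simp add: power2_eq_square)
      then show ?thesis using S0 a by simp
    next
      case False
      then have D: "D > 0" using E by (simp add: D_def)
      define u where "u v = norm (fst v - snd v) powr k / D" for v :: "'a \<times> 'a"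
      have nV: "norm (fst v - snd v) > 0" if "v \<in> V" for v
        using that by (auto simp: V_def)
      have "real m powr (a + 1) - (real m)\<^sup>2 \<le> (a - 1) * (\<Sum>v\<in>V. u v powr (- a))"
      proof (rule sum_powr_ge_of_counting_bound[OF finV cV])
        fix v assume "v \<in> V" then show "u v > 0"
          using nV[of v] D by (simp add: u_def)
      next
        fix t :: real assume t: "0 < t" "t \<le> 1"
        \<comment> \<open>Chosen so that \<open>D * \<delta> powr (- k) = 1 / t\<close>; since
          \<open>t \<le> 1\<close>, this is the larger entry of the maximum.\<close>
        define \<delta> where "\<delta> = (D * t) powr (1 / k)"
        have d: "\<delta> > 0" using D t by (simp add: \<delta>_def)
        have dk: "\<delta> powr k = D * t" using D t E by (simp add: \<delta>_def powr_powr)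
        then have "D * \<delta> powr (- k) = 1 / t" using D by (simp add: powr_minus field_simps)
        then have mx: "max (D * \<delta> powr (- k)) 1 = 1 / t" using t by simp
        have "{v \<in> V. norm (fst v - snd v) \<le> \<delta>} \<subseteq> {v \<in> V. u v \<le> t}"
        proof clarify
          fix p q :: 'a assume "norm (fst (p, q) - snd (p, q)) \<le> \<delta>"
          then have "norm (fst (p, q) - snd (p, q)) powr k \<le> D * t"
            unfolding dk[symmetric] using E by (intro powr_mono2) auto
          then show "u (p, q) \<le> t" using D by (simp add: u_def field_simps)
        qed
        then have "card {v \<in> V. norm (fst v - snd v) \<le> \<delta>} \<le> card {v \<in> V. u v \<le> t}"
          using finV by (intro card_mono) auto
        moreover have "(real m)\<^sup>2 * t \<le> real m + real (card {v \<in> V. norm (fst v - snd v) \<le> \<delta>})"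
          using close[OF d] t unfolding mx by (simp add: field_simps)
        ultimately show "(real m)\<^sup>2 * t - real m \<le> real (card {v \<in> V. u v \<le> t})"
          by linarith
      qed (use a m in auto)
      also have "(\<Sum>v\<in>V. u v powr (- a)) = (\<Sum>v\<in>V. D powr a * norm (fst v - snd v) powr (- s))"
      proof (rule sum.cong)
        fix v assume "v \<in> V"
        show "u v powr (- a) = D powr a * norm (fst v - snd v) powr (- s)"
          using nV[OF \<open>v \<in> V\<close>] D E unfolding u_def
          by (simp add: powr_divide powr_powr a_def powr_minus field_simps)
      qed simp
      finally show ?thesis by (simp add: sum_distrib_left mult_ac)
    qed
  qed
  then show ?thesis
    by (simp add: V_def m_def a_def D_def case_prod_unfold)
qed

text \<open>Apply \<open>energy_sum_ge\<close> to \<open>P \<inter> E\<close>, enlarge both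
  \<open>m\<^sup>2\<close> and the energy sum to those of \<open>P\<close>, factor out
  \<open>n\<^sup>2\<close>, and take the root of order \<open>s / k + 1\<close>.\<close>

lemma card_inter_le_energy:
  fixes E P :: "'a::real_normed_vector set"
  assumes E: "compact E" "0 < k" "0 \<le> C"
    and cov: "\<And>\<delta>. \<delta> > 0 \<Longrightarrow> real (covering_number E \<delta>) \<le> max (C * \<delta> powr (- k)) 1"
    and P: "finite P" "card P = n" and s: "k < s"
  shows "real (card (P \<inter> E))
    \<le> (1 + (2 powr k * C) powr (s / k) * (s / k - 1) * s_energy s P) powr (1 / (s / k + 1))
      * real n powr (2 / (s / k + 1))"
proof (cases "n = 0")
  case True
  then show ?thesis using P by simp
next
  case False
  define a where "a = s / k"
  define m where "m = card (P \<inter> E)"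
  define K where "K = (2 powr k * C) powr a * (a - 1)"
  have a: "a > 1" using E s by (simp add: a_def)
  have K: "K \<ge> 0" using a by (simp add: K_def)
  let ?S = "\<lambda>Q. \<Sum>(p, q) \<in> {(p, q). p \<in> Q \<and> q \<in> Q \<and> p \<noteq> q}. norm (p - q) powr (- s)"
  have mono: "?S (P \<inter> E) \<le> ?S P"
  proof (rule sum_mono2)
    show "finite {(p, q). p \<in> P \<and> q \<in> P \<and> p \<noteq> q}"
      by (rule finite_subset[of _ "P \<times> P"]) (use P in auto)
  qed auto
  have S: "?S P = (real n)\<^sup>2 * s_energy s P"
    using False P by (simp add: s_energy_def)
  have I: "0 \<le> s_energy s P"
    unfolding s_energy_def by (intro divide_nonneg_nonneg sum_nonneg) auto
  have "m \<le> n" using P by (auto simp: m_def intro: card_mono)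
  have "real m powr (a + 1) \<le> (real m)\<^sup>2 + K * ?S (P \<inter> E)"
    using energy_sum_ge[OF E cov, of "P \<inter> E" s] P s by (simp add: m_def K_def a_def)
  also have "\<dots> \<le> (real n)\<^sup>2 + K * ?S P"
    using mono K \<open>m \<le> n\<close> by (intro add_mono mult_left_mono power_mono) auto
  also have "\<dots> = (1 + K * s_energy s P) * (real n)\<^sup>2"
    unfolding S by (simp add: algebra_simps)
  finally have "real m powr (a + 1) \<le> (1 + K * s_energy s P) * (real n)\<^sup>2" .
  then have "(real m powr (a + 1)) powr (1 / (a + 1)) \<le> ((1 + K * s_energy s P) * (real n)\<^sup>2) powr (1 / (a + 1))"
    using a by (intro powr_mono2) auto
  also have "\<dots> = (1 + K * s_energy s P) powr (1 / (a + 1)) * ((real n)\<^sup>2) powr (1 / (a + 1))"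
    by (rule powr_mult)
  also have "((real n)\<^sup>2) powr (1 / (a + 1)) = real n powr (2 / (a + 1))"
    using False by (simp add: powr_powr flip: powr_numeral)
  finally show ?thesis
    using a by (simp add: powr_powr m_def K_def a_def)
qed

subsection \<open>A Cantor dust\<close>

definition gap :: "real \<Rightarrow> nat \<Rightarrow> real" where
  "gap r i = r ^ i / (real i + 1)"

text \<open>Binary digits of all coordinates together are encoded as the set of (position,
  coordinate) pairs with digit 1, so a level is the image of a power set.\<close>

definition digit_point :: "real \<Rightarrow> (nat \<times> 'd) set \<Rightarrow> real ^ 'd::finite" where
  "digit_point r S = (\<chi> c. \<Sum>i | (i, c) \<in> S. gap r i)"

definition cantor_level :: "real \<Rightarrow> nat \<Rightarrow> (real ^ 'd::finite) set" where
  "cantor_level r L = digit_point r ` Pow ({..<L} \<times> UNIV)"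

text \<open>The closure replaces infinite digit strings: no series occur, and closedness is
  immediate.\<close>

definition cantor_dust :: "real \<Rightarrow> (real ^ 'd::finite) set" where
  "cantor_dust r = closure (\<Union>L. cantor_level r L)"

section \<open>Subset sums of gaps\<close>

lemma gap_pos: "0 < r \<Longrightarrow> 0 < gap r i"
  by (simp add: gap_def)

text \<open>Peel off the first gap; since \<open>2 * r \<le> 1\<close>, the bound for the remaining
  gaps is at most that first gap.\<close>

lemma sum_gap_interval_le:
  assumes "0 < r" "r \<le> 1 / 2"
  shows "(\<Sum>i\<in>{j..<j + n}. gap r i) \<le> 2 * r ^ j / (real j + 1)"
proof (induction n arbitrary: j)
  case 0
  then show ?case using assms by simp
next
  case (Suc n)
  have "(\<Sum>i\<in>{j..<j + Suc n}. gap r i) = gap r j + (\<Sum>i\<in>{Suc j..<Suc j + n}. gap r i)"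
    by (simp add: sum.atLeast_Suc_lessThan)
  also have "\<dots> \<le> r ^ j / (real j + 1) + 2 * r ^ Suc j / (real (Suc j) + 1)"
    unfolding gap_def using Suc.IH[of "Suc j"] by (intro add_mono) (auto simp: gap_def)
  also have "2 * r ^ Suc j / (real (Suc j) + 1) \<le> r ^ j / (real j + 1)"
    using assms by (intro frac_le) auto
  finally show ?case by simp
qed

lemma sum_gap_tail_le:
  assumes r: "0 < r" "r \<le> 1 / 2" and A: "finite A" "A \<subseteq> {j..}"
  shows "sum (gap r) A \<le> 2 * r ^ j / (real j + 1)"
proof -
  obtain N where N: "A \<subseteq> {..<N}"
    using A(1) finite_nat_iff_bounded by blast
  have "A \<subseteq> {j..<j + N}"
    using N A by fastforce
  then have "sum (gap r) A \<le> sum (gap r) {j..<j + N}"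
    using r by (intro sum_mono2) (auto intro: less_imp_le[OF gap_pos])
  then show ?thesis using sum_gap_interval_le[OF r, of j N] by linarith
qed

lemma sum_gap_split:
  assumes "finite A"
  shows "sum (gap r) A = sum (gap r) (A \<inter> {..<j}) + sum (gap r) (A \<inter> {j..})"
  by (subst sum.union_disjoint[symmetric]) (use assms in \<open>auto intro: arg_cong[where f="sum _"]\<close>)

text \<open>The common digits cancel, and both tails lie between 0 and
  \<open>2 * r ^ j\<close>.\<close>

lemma sum_gap_agree:
  assumes r: "0 < r" "r \<le> 1 / 2" and fin: "finite A" "finite B"
    and agree: "A \<inter> {..<j} = B \<inter> {..<j}"
  shows "\<bar>sum (gap r) A - sum (gap r) B\<bar> \<le> 2 * r ^ j"
proof -
  have *: "0 \<le> sum (gap r) (F \<inter> {j..}) \<and> sum (gap r) (F \<inter> {j..}) \<le> 2 * r ^ j" if "finite F" for F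
  proof
    have "sum (gap r) (F \<inter> {j..}) \<le> 2 * r ^ j / (real j + 1)"
      using that by (intro sum_gap_tail_le r) auto
    also have "\<dots> \<le> 2 * r ^ j"
      using r by (simp add: field_simps)
    finally show "sum (gap r) (F \<inter> {j..}) \<le> 2 * r ^ j" .
  qed (use r in \<open>auto intro!: sum_nonneg less_imp_le[OF gap_pos]\<close>)
  show ?thesis
    using *[OF fin(1)] *[OF fin(2)] sum_gap_split[OF fin(1), of r j] sum_gap_split[OF fin(2), of r j]
    unfolding agree by linarith
qed

text \<open>The tail of \<open>B\<close> starts one position later and is at most
  \<open>r ^ i / (i + 2)\<close>, against the gap \<open>r ^ i / (i + 1)\<close> in
  \<open>A\<close>. The denominators alone guarantee a positive difference, even at
  \<open>r = 1 / 2\<close>.\<close>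

lemma sum_gap_first_difference:
  assumes r: "0 < r" "r \<le> 1 / 2" and fin: "finite A" "finite B"
    and agree: "A \<inter> {..<i} = B \<inter> {..<i}" and i: "i \<in> A" "i \<notin> B"
  shows "r ^ i / ((real i + 1) * (real i + 2)) \<le> sum (gap r) A - sum (gap r) B"
proof -
  have "gap r i = sum (gap r) {i}" by simp
  also have "\<dots> \<le> sum (gap r) (A \<inter> {i..})"
    using fin i r by (intro sum_mono2) (auto intro: less_imp_le[OF gap_pos])
  finally have 1: "gap r i \<le> sum (gap r) (A \<inter> {i..})" .
  have "B \<inter> {i..} = B \<inter> {Suc i..}"
    using i by (auto simp: le_eq_less_or_eq Suc_le_eq)
  then have "sum (gap r) (B \<inter> {i..}) \<le> 2 * r ^ Suc i / (real (Suc i) + 1)"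
    using fin by (metis sum_gap_tail_le r Int_lower2 finite_Int)
  also have "\<dots> \<le> r ^ i / (real i + 2)"
    using r by (intro frac_le) auto
  finally have 2: "sum (gap r) (B \<inter> {i..}) \<le> r ^ i / (real i + 2)" .
  have "r ^ i / ((real i + 1) * (real i + 2)) = gap r i - r ^ i / (real i + 2)"
    unfolding gap_def by (simp add: field_simps)
  then show ?thesis
    using 1 2 sum_gap_split[OF fin(1), of r i] sum_gap_split[OF fin(2), of r i]
    unfolding agree by linarith
qed

section \<open>Agreement and separation of digit points\<close>

lemma finite_digits:
  fixes L :: nat
  shows "S \<subseteq> {..<L} \<times> (UNIV :: 'd set) \<Longrightarrow> finite {i. (i, c) \<in> S}"
  by (rule finite_subset[of _ "{..<L}"]) auto

lemma norm_digit_point_agree: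
  fixes S T :: "(nat \<times> 'd::finite) set"
  assumes r: "0 < r" "r \<le> 1 / 2" and S: "S \<subseteq> {..<L} \<times> UNIV" and T: "T \<subseteq> {..<L} \<times> UNIV"
    and agree: "S \<inter> ({..<j} \<times> UNIV) = T \<inter> ({..<j} \<times> UNIV)"
  shows "norm (digit_point r S - digit_point r T) \<le> 2 * real CARD('d) * r ^ j"
proof -
  \<comment> \<open>Comparison with the l1 norm is the source of the factor
    \<open>CARD('d)\<close>.\<close>
  have "norm (digit_point r S - digit_point r T) \<le> (\<Sum>c\<in>UNIV. \<bar>(digit_point r S - digit_point r T) $ c\<bar>)"
    by (rule norm_le_l1_cart)
  also have "\<dots> \<le> (\<Sum>c\<in>(UNIV :: 'd set). 2 * r ^ j)"
  proof (rule sum_mono)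
    fix c :: 'd
    have "{i. (i, c) \<in> S} \<inter> {..<j} = {i. (i, c) \<in> T} \<inter> {..<j}"
      using agree by blast
    then show "\<bar>(digit_point r S - digit_point r T) $ c\<bar> \<le> 2 * r ^ j"
      unfolding digit_point_def using sum_gap_agree[OF r finite_digits[OF S] finite_digits[OF T]] by simp
  qed
  finally show ?thesis by simp
qed

lemma digit_point_separation:
  fixes S T :: "(nat \<times> 'd::finite) set"
  assumes r: "0 < r" "r \<le> 1 / 2" and S: "S \<subseteq> {..<L} \<times> UNIV" and T: "T \<subseteq> {..<L} \<times> UNIV"
    and "S \<noteq> T"
  obtains i where "i < L" "S \<inter> ({..<i} \<times> UNIV) = T \<inter> ({..<i} \<times> UNIV)"
    "r ^ i / ((real i + 1) * (real i + 2)) \<le> norm (digit_point r S - digit_point r T)"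
proof -
  \<comment> \<open>The minimum is over all coordinates at once, so below \<open>i\<close> the
    strings agree in every coordinate; one coordinate differing at \<open>i\<close> bounds the norm
    from below.\<close>
  define i where "i = (LEAST i. \<exists>c. ((i, c) \<in> S) \<noteq> ((i, c) \<in> T))"
  have "\<exists>i c. ((i, c) \<in> S) \<noteq> ((i, c) \<in> T)"
    using \<open>S \<noteq> T\<close> by auto
  then have "\<exists>c. ((i, c) \<in> S) \<noteq> ((i, c) \<in> T)"
    unfolding i_def by (rule LeastI_ex)
  then obtain c where c: "((i, c) \<in> S) \<noteq> ((i, c) \<in> T)" ..
  have less: "((l, b) \<in> S) = ((l, b) \<in> T)" if "l < i" for l b
    using not_less_Least that unfolding i_def by blast
  have "i < L" using c S T by auto
  moreover have "S \<inter> ({..<i} \<times> UNIV) = T \<inter> ({..<i} \<times> UNIV)"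
    using less by auto
  moreover have "r ^ i / ((real i + 1) * (real i + 2)) \<le> norm (digit_point r S - digit_point r T)"
  proof -
    have ag: "{i. (i, c) \<in> S} \<inter> {..<i} = {i. (i, c) \<in> T} \<inter> {..<i}"
      using less by auto
    have "r ^ i / ((real i + 1) * (real i + 2)) \<le> \<bar>sum (gap r) {i. (i, c) \<in> S} - sum (gap r) {i. (i, c) \<in> T}\<bar>"
      using c sum_gap_first_difference[OF r finite_digits[OF S] finite_digits[OF T] ag]
        sum_gap_first_difference[OF r finite_digits[OF T] finite_digits[OF S] ag[symmetric]]
      by fastforce
    also have "\<dots> = \<bar>(digit_point r S - digit_point r T) $ c\<bar>"
      by (simp add: digit_point_def)
    also have "\<dots> \<le> norm (digit_point r S - digit_point r T)"
      by (rule component_le_norm_cart)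
    finally show ?thesis .
  qed
  ultimately show ?thesis by (rule that)
qed

lemma inj_on_digit_point:
  assumes "0 < r" "r \<le> 1 / 2"
  shows "inj_on (digit_point r) (Pow ({..<L} \<times> (UNIV :: 'd::finite set)))"
proof (rule inj_onI, rule ccontr)
  fix S T :: "(nat \<times> 'd) set"
  assume "S \<in> Pow ({..<L} \<times> UNIV)" "T \<in> Pow ({..<L} \<times> UNIV)"
    and eq: "digit_point r S = digit_point r T" and "S \<noteq> T"
  then obtain i where "r ^ i / ((real i + 1) * (real i + 2)) \<le> norm (digit_point r S - digit_point r T)"
    using digit_point_separation[OF assms] by (metis PowD)
  moreover have "0 < r ^ i / ((real i + 1) * (real i + 2))"
    using assms by simp
  ultimately show False using eq by simp
qed

section \<open>Compactness and covering numbers of the dust\<close>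

lemma finite_cantor_level: "finite (cantor_level r L)"
  by (simp add: cantor_level_def)

lemma card_cantor_level:
  assumes "0 < r" "r \<le> 1 / 2"
  shows "card (cantor_level r L :: (real ^ 'd::finite) set) = 2 ^ (L * CARD('d))"
  unfolding cantor_level_def
  by (simp add: card_image[OF inj_on_digit_point[OF assms]] card_Pow card_cartesian_product)

text \<open>Erasing all digits from position \<open>j\<close> on gives a level-\<open>j\<close>
  point nearby, with an error independent of \<open>L\<close>.\<close>

lemma cantor_level_covered:
  assumes r: "0 < r" "r \<le> 1 / 2"
  shows "(cantor_level r L :: (real ^ 'd::finite) set)
    \<subseteq> (\<Union>x\<in>cantor_level r j. cball x (2 * real CARD('d) * r ^ j))"
proof
  fix y :: "real ^ 'd" assume "y \<in> cantor_level r L"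
  then obtain S where S: "S \<subseteq> {..<L} \<times> UNIV" "y = digit_point r S"
    by (auto simp: cantor_level_def)
  define T where "T = S \<inter> ({..<j} \<times> UNIV)"
  have "norm (digit_point r T - digit_point r S) \<le> 2 * real CARD('d) * r ^ j"
    by (rule norm_digit_point_agree[OF r _ S(1)]) (use S in \<open>auto simp: T_def\<close>)
  moreover have "digit_point r T \<in> cantor_level r j"
    by (auto simp: cantor_level_def T_def)
  ultimately show "y \<in> (\<Union>x\<in>cantor_level r j. cball x (2 * real CARD('d) * r ^ j))"
    using S by (auto simp: dist_norm)
qed

text \<open>The cover is a finite union of closed balls, hence closed, so it survives the
  closure.\<close>

lemma cantor_dust_covered:
  assumes r: "0 < r" "r \<le> 1 / 2"
  shows "(cantor_dust r :: (real ^ 'd::finite) set)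
    \<subseteq> (\<Union>x\<in>cantor_level r j. cball x (2 * real CARD('d) * r ^ j))"
  unfolding cantor_dust_def
  by (intro closure_minimal UN_least cantor_level_covered[OF r] closed_UN finite_cantor_level) auto

lemma compact_cantor_dust:
  assumes r: "0 < r" "r \<le> 1 / 2"
  shows "compact (cantor_dust r)"
proof -
  have "bounded (cantor_dust r)"
    by (rule bounded_subset[OF _ cantor_dust_covered[OF r, of 0]])
      (intro bounded_UN finite_cantor_level ballI bounded_cball)
  then show ?thesis
    unfolding compact_eq_bounded_closed by (simp add: cantor_dust_def)
qed

text \<open>The condition \<open>k \<le> d\<close> is exactly what brings the ratio down to
  \<open>1 / 2\<close>.\<close>

lemma dust_ratio_bounds:
  fixes k d :: real
  assumes "0 < k" "k \<le> d" and r: "r = 2 powr (- d / k)"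
  shows "0 < r" "r \<le> 1 / 2"
proof -
  have "r \<le> 2 powr (- 1)"
    unfolding r using assms by (intro powr_mono) (auto simp: field_simps)
  then show "r \<le> 1 / 2" by (simp add: powr_minus)
qed (simp add: r)

text \<open>Use the first level \<open>j\<close> whose balls fit into radius
  \<open>\<delta>\<close>. Level \<open>j - 1\<close> does not fit, which bounds its number of
  points by a multiple of \<open>\<delta> powr (- k)\<close>; one more level costs
  \<open>2 ^ CARD('d)\<close>.\<close>

lemma covering_number_cantor_dust:
  fixes k :: real
  assumes k: "0 < k" "k \<le> real CARD('d)" and r: "r = 2 powr (- real CARD('d) / k)" and \<delta>: "\<delta> > 0"
  shows "real (covering_number (cantor_dust r :: (real ^ 'd::finite) set) \<delta>)
    \<le> max (2 ^ CARD('d) * (2 * real CARD('d)) powr k * \<delta> powr (- k)) 1"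
proof -
  let ?d = "CARD('d)"
  note r01 = dust_ratio_bounds[OF k r]
  have N: "covering_number (cantor_dust r :: (real ^ 'd) set) \<delta> \<le> 2 ^ (j * ?d)"
    if "2 * real ?d * r ^ j \<le> \<delta>" for j
  proof -
    have "(cantor_dust r :: (real ^ 'd) set) \<subseteq> (\<Union>x\<in>cantor_level r j. cball x \<delta>)"
      by (rule subset_trans[OF cantor_dust_covered[OF r01, of j]])
        (intro UN_mono order_refl subset_cball that)
    from covering_number_le[OF finite_cantor_level this] show ?thesis
      by (simp add: card_cantor_level[OF r01])
  qed
  have "(\<lambda>j. 2 * real ?d * r ^ j) \<longlonglongrightarrow> 2 * real ?d * 0"
    using r01 by (intro tendsto_intros LIMSEQ_realpow_zero) auto
  then have "\<forall>\<^sub>F j in sequentially. 2 * real ?d * r ^ j < \<delta>"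
    using \<delta> by (intro order_tendstoD(2)) auto
  then have ex: "\<exists>j. 2 * real ?d * r ^ j \<le> \<delta>"
    by (meson eventually_sequentially less_imp_le order_refl)
  define j where "j = (LEAST j. 2 * real ?d * r ^ j \<le> \<delta>)"
  have j: "2 * real ?d * r ^ j \<le> \<delta>"
    unfolding j_def using ex by (rule LeastI_ex)
  show ?thesis
  proof (cases j)
    case 0
    then have "covering_number (cantor_dust r :: (real ^ 'd) set) \<delta> \<le> 1"
      using N[OF j] by simp
    then show ?thesis by (simp add: max.coboundedI2)
  next
    case (Suc i)
    then have "\<not> 2 * real ?d * r ^ i \<le> \<delta>"
      unfolding j_def by (metis lessI not_less_Least)
    then have "\<delta> \<le> 2 * real ?d * r ^ i" by simp
    then have "(2 * real ?d * r ^ i) powr (- k) \<le> \<delta> powr (- k)"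
      using \<delta> k by (intro powr_mono2') auto
    \<comment> \<open>The defining property of the ratio:
      \<open>r powr (- k) = 2 ^ CARD('d)\<close>.\<close>
    moreover have "(r ^ i) powr (- k) = 2 ^ (i * ?d)"
      unfolding r using k by (simp add: powr_powr flip: powr_realpow) (simp add: field_simps)
    ultimately have "(2 * real ?d) powr (- k) * 2 ^ (i * ?d) \<le> \<delta> powr (- k)"
      by (simp add: powr_mult)
    then have "2 ^ (i * ?d) \<le> (2 * real ?d) powr k * \<delta> powr (- k)"
      by (simp add: powr_minus field_simps)
    then have "2 ^ ?d * 2 ^ (i * ?d) \<le> 2 ^ ?d * ((2 * real ?d) powr k * \<delta> powr (- k))"
      by (intro mult_left_mono) auto
    moreover have "real (covering_number (cantor_dust r :: (real ^ 'd) set) \<delta>) \<le> 2 ^ ?d * 2 ^ (i * ?d)"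
      using N[OF j] Suc by (simp add: power_add flip: of_nat_le_iff[where 'a=real])
    ultimately have "real (covering_number (cantor_dust r :: (real ^ 'd) set) \<delta>)
        \<le> 2 ^ ?d * ((2 * real ?d) powr k * \<delta> powr (- k))"
      by linarith
    then show ?thesis
      unfolding mult.assoc by (rule max.coboundedI1)
  qed
qed

section \<open>Energy of one level of the dust\<close>

lemma card_agreeing_digits:
  fixes S :: "(nat \<times> 'd::finite) set"
  shows "card {T. T \<subseteq> {..<L} \<times> UNIV \<and> S \<inter> ({..<i} \<times> UNIV) = T \<inter> ({..<i} \<times> UNIV)}
    \<le> 2 ^ ((L - i) * CARD('d))"
proof -
  let ?A = "{T. T \<subseteq> {..<L} \<times> (UNIV :: 'd set) \<and> S \<inter> ({..<i} \<times> UNIV) = T \<inter> ({..<i} \<times> UNIV)}"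
  have "inj_on (\<lambda>T. T \<inter> ({i..} \<times> UNIV)) ?A"
  proof (rule inj_onI)
    fix T U :: "(nat \<times> 'd) set"
    have split: "F = (F \<inter> ({..<i} \<times> UNIV)) \<union> (F \<inter> ({i..} \<times> UNIV))" for F :: "(nat \<times> 'd) set"
      by auto
    assume "T \<in> ?A" "U \<in> ?A" "T \<inter> ({i..} \<times> UNIV) = U \<inter> ({i..} \<times> UNIV)"
    then show "T = U"
      using split[of T] split[of U] by auto
  qed
  then have "card ?A \<le> card (Pow ({i..<L} \<times> (UNIV :: 'd set)))"
    by (rule card_inj_on_le) auto
  then show ?thesis by (simp add: card_Pow card_cartesian_product)
qed

text \<open>Fix \<open>S\<close> and group the other strings by their level \<open>i\<close> of
  separation: at most \<open>2 ^ ((L - i) * d)\<close> strings, each contributing at most a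
  polynomial in \<open>L\<close> times \<open>(r ^ i) powr (- s)\<close>. As \<open>s > k\<close>,
  every group is bounded by \<open>Z\<close>; there are \<open>L\<close> groups per row and
  \<open>X\<close> rows.\<close>

lemma cantor_level_energy_sum_le:
  fixes k s :: real and L :: nat
  assumes k: "0 < k" "k \<le> real CARD('d)" and r: "r = 2 powr (- real CARD('d) / k)" and s: "k < s"
  defines "X \<equiv> 2 ^ (L * CARD('d))"
  shows "(\<Sum>(p, q) \<in> {(p, q). p \<in> cantor_level r L \<and> q \<in> cantor_level r L \<and> p \<noteq> q}.
      norm (p - q :: real ^ 'd::finite) powr (- s))
    \<le> (real L + 1) powr (2 * s + 1) * X powr (1 + s / k)"
proof -
  let ?d = "CARD('d)"
  let ?W = "Pow ({..<L} \<times> (UNIV :: 'd set))"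
  define h where "h S T = norm (digit_point r S - digit_point r T :: real ^ 'd) powr (- s)" for S T
  define Z where "Z = ((real L + 1)\<^sup>2) powr s * X powr (s / k)"
  note r01 = dust_ratio_bounds[OF k r]
  have row: "(\<Sum>T\<in>?W - {S}. h S T) \<le> real L * Z" if S: "S \<in> ?W" for S
  proof -
    define D where "D T = (SOME i. i < L \<and> S \<inter> ({..<i} \<times> UNIV) = T \<inter> ({..<i} \<times> UNIV)
      \<and> r ^ i / ((real i + 1) * (real i + 2)) \<le> norm (digit_point r S - digit_point r T))" for T
    have D: "D T < L" "S \<inter> ({..<D T} \<times> UNIV) = T \<inter> ({..<D T} \<times> UNIV)"
      "r ^ D T / ((real (D T) + 1) * (real (D T) + 2)) \<le> norm (digit_point r S - digit_point r T)"
      if T: "T \<in> ?W - {S}" for T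
    proof -
      have "\<exists>i. i < L \<and> S \<inter> ({..<i} \<times> UNIV) = T \<inter> ({..<i} \<times> UNIV)
        \<and> r ^ i / ((real i + 1) * (real i + 2)) \<le> norm (digit_point r S - digit_point r T)"
        using digit_point_separation[OF r01, of S L T] S T by (metis Diff_iff Pow_iff insertI1)
      then have "D T < L \<and> S \<inter> ({..<D T} \<times> UNIV) = T \<inter> ({..<D T} \<times> UNIV)
        \<and> r ^ D T / ((real (D T) + 1) * (real (D T) + 2)) \<le> norm (digit_point r S - digit_point r T)"
        unfolding D_def by (rule someI_ex)
      then show "D T < L" "S \<inter> ({..<D T} \<times> UNIV) = T \<inter> ({..<D T} \<times> UNIV)"
        "r ^ D T / ((real (D T) + 1) * (real (D T) + 2)) \<le> norm (digit_point r S - digit_point r T)"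
        by auto
    qed
    have "(\<Sum>T\<in>?W - {S}. h S T) = (\<Sum>i<L. \<Sum>T | T \<in> ?W - {S} \<and> D T = i. h S T)"
      using D(1) by (intro sum.group[symmetric]) auto
    also have "\<dots> \<le> (\<Sum>i<L. Z)"
    proof (rule sum_mono)
      fix i assume "i \<in> {..<L}"
      then have i: "i < L" by simp
      let ?V = "{T. T \<in> ?W - {S} \<and> D T = i}"
      define b where "b = ((real L + 1)\<^sup>2) powr s * (r ^ i) powr (- s)"
      have "h S T \<le> b" if "T \<in> ?V" for T
      proof -
        \<comment> \<open>As \<open>i < L\<close>, both factors are at most \<open>L + 1\<close>,
          which makes the loss independent of \<open>i\<close>.\<close>
        have "r ^ i / (real L + 1)\<^sup>2 \<le> r ^ i / ((real i + 1) * (real i + 2))"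
          unfolding power2_eq_square using r01 i by (intro divide_left_mono mult_mono) auto
        also have "\<dots> \<le> norm (digit_point r S - digit_point r T)"
          using D(3)[of T] that by auto
        finally have "h S T \<le> (r ^ i / (real L + 1)\<^sup>2) powr (- s)"
          unfolding h_def using r01 k s by (intro powr_mono2') auto
        also have "\<dots> = b"
          unfolding b_def using r01 by (simp add: powr_divide powr_minus field_simps)
        finally show ?thesis .
      qed
      then have "(\<Sum>T\<in>?V. h S T) \<le> real (card ?V) * b"
        by (rule sum_bounded_above)
      also have "\<dots> \<le> 2 ^ ((L - i) * ?d) * b"
      proof (rule mult_right_mono)
        have "card ?V \<le> card {T. T \<subseteq> {..<L} \<times> (UNIV :: 'd set) \<and> S \<inter> ({..<i} \<times> UNIV) = T \<inter> ({..<i} \<times> UNIV)}"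
        proof (rule card_mono)
          show "finite {T. T \<subseteq> {..<L} \<times> (UNIV :: 'd set) \<and> S \<inter> ({..<i} \<times> UNIV) = T \<inter> ({..<i} \<times> UNIV)}"
            by (rule finite_subset[of _ ?W]) auto
          show "?V \<subseteq> {T. T \<subseteq> {..<L} \<times> (UNIV :: 'd set) \<and> S \<inter> ({..<i} \<times> UNIV) = T \<inter> ({..<i} \<times> UNIV)}"
            using D(2) by blast
        qed
        then have "card ?V \<le> 2 ^ ((L - i) * ?d)"
          using card_agreeing_digits[of L S i] by linarith
        then have "real (card ?V) \<le> real (2 ^ ((L - i) * ?d))"
          by (rule of_nat_mono)
        then show "real (card ?V) \<le> 2 ^ ((L - i) * ?d)" by simp
      qed (simp add: b_def)
      also have "\<dots> \<le> Z"
      proof -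
        have "2 ^ ((L - i) * ?d) * (r ^ i) powr (- s) = 2 powr (real ((L - i) * ?d) + real (i * ?d) * (s / k))"
          unfolding r by (simp add: powr_powr powr_add flip: powr_realpow) (simp add: field_simps)
        \<comment> \<open>Multiplying \<open>(L - i) * d\<close> by \<open>s / k > 1\<close> merges
          the two exponents.\<close>
        also have "\<dots> \<le> 2 powr (real (L * ?d) * (s / k))"
        proof (intro powr_mono)
          have "real ((L - i) * ?d) * 1 \<le> real ((L - i) * ?d) * (s / k)"
            using s k by (intro mult_left_mono) auto
          then have "real ((L - i) * ?d) + real (i * ?d) * (s / k) \<le> real ((L - i) * ?d) * (s / k) + real (i * ?d) * (s / k)"
            by simp
          also have "\<dots> = real ((L - i) * ?d + i * ?d) * (s / k)"
            by (simp only: of_nat_add distrib_right)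
          also have "(L - i) * ?d + i * ?d = L * ?d"
            using i by (simp flip: distrib_right)
          finally show "real ((L - i) * ?d) + real (i * ?d) * (s / k) \<le> real (L * ?d) * (s / k)" .
        qed auto
        also have "\<dots> = X powr (s / k)"
          unfolding X_def by (simp add: powr_powr flip: powr_realpow)
        finally have "((real L + 1)\<^sup>2) powr s * (2 ^ ((L - i) * ?d) * (r ^ i) powr (- s)) \<le> Z"
          unfolding Z_def by (intro mult_left_mono) auto
        then show ?thesis by (simp add: b_def mult_ac)
      qed
      finally show "(\<Sum>T\<in>?V. h S T) \<le> Z" .
    qed
    finally show ?thesis by simp
  qed
  let ?I = "map_prod (digit_point r :: _ \<Rightarrow> real ^ 'd) (digit_point r :: _ \<Rightarrow> real ^ 'd)"
  have inj: "inj_on (digit_point r :: _ \<Rightarrow> real ^ 'd) ?W"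
    by (rule inj_on_digit_point[OF r01])
  have "{(p, q). p \<in> cantor_level r L \<and> q \<in> cantor_level r L \<and> p \<noteq> q}
      = ?I ` (SIGMA S:?W. ?W - {S})"
  proof (rule equalityI)
    show "{(p, q). p \<in> cantor_level r L \<and> q \<in> cantor_level r L \<and> p \<noteq> q} \<subseteq> ?I ` (SIGMA S:?W. ?W - {S})"
    proof clarify
      fix p q :: "real ^ 'd" assume "p \<in> cantor_level r L" "q \<in> cantor_level r L" "p \<noteq> q"
      then obtain S T where "S \<in> ?W" "T \<in> ?W" and pq: "p = digit_point r S" "q = digit_point r T"
        unfolding cantor_level_def by blast
      then have "(S, T) \<in> (SIGMA S:?W. ?W - {S})"
        using \<open>p \<noteq> q\<close> by blast
      then show "(p, q) \<in> ?I ` (SIGMA S:?W. ?W - {S})"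
        by (rule rev_image_eqI) (simp add: pq)
    qed
    show "?I ` (SIGMA S:?W. ?W - {S}) \<subseteq> {(p, q). p \<in> cantor_level r L \<and> q \<in> cantor_level r L \<and> p \<noteq> q}"
      by (auto simp: cantor_level_def dest: inj_onD[OF inj])
  qed
  moreover have "inj_on ?I (SIGMA S:?W. ?W - {S})"
    by (rule inj_on_subset[OF map_prod_inj_on[OF inj inj]]) auto
  ultimately have "(\<Sum>(p, q) \<in> {(p, q). p \<in> cantor_level r L \<and> q \<in> cantor_level r L \<and> p \<noteq> q}.
      norm (p - q :: real ^ 'd) powr (- s)) = (\<Sum>(S, T)\<in>(SIGMA S:?W. ?W - {S}). h S T)"
    by (simp add: sum.reindex h_def case_prod_unfold)
  also have "\<dots> = (\<Sum>S\<in>?W. \<Sum>T\<in>?W - {S}. h S T)"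
    by (rule sum.Sigma[symmetric]) auto
  also have "\<dots> \<le> (\<Sum>S\<in>?W. real L * Z)"
    by (intro sum_mono row)
  also have "\<dots> = X * (real L * Z)"
    by (simp add: X_def card_Pow card_cartesian_product)
  also have "\<dots> \<le> X * ((real L + 1) * Z)"
    by (intro mult_left_mono mult_right_mono) (auto simp: X_def Z_def)
  also have "\<dots> = (real L + 1) powr (2 * s + 1) * X powr (1 + s / k)"
    by (simp add: Z_def X_def powr_add powr_powr flip: powr_numeral)
  finally show ?thesis .
qed

section \<open>Padding with distant points, and sharpness\<close>

text \<open>The new points lie on a ray at unit spacing, beginning at distance 1 beyond a ball
  containing \<open>F\<close>. Every pair involving one of them is at distance at least 1 and
  contributes at most 1.\<close>

lemma add_distant_points:
  fixes F :: "'a::euclidean_space set"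
  assumes "finite F" "0 < s"
  obtains P where "finite P" "F \<subseteq> P" "card P = card F + N"
    "(\<Sum>(p, q) \<in> {(p, q). p \<in> P \<and> q \<in> P \<and> p \<noteq> q}. norm (p - q) powr (- s))
      \<le> (\<Sum>(p, q) \<in> {(p, q). p \<in> F \<and> q \<in> F \<and> p \<noteq> q}. norm (p - q) powr (- s)) + (real (card P))\<^sup>2"
proof -
  obtain B where B: "\<And>p. p \<in> F \<Longrightarrow> norm p \<le> B" "B > 0"
    using finite_imp_bounded[OF assms(1)] bounded_pos by metis
  obtain v :: 'a where v: "norm v = 1"
    using vector_choose_size[of 1] by auto
  define g where "g j = (B + 1 + real j) *\<^sub>R v" for j :: nat
  have g: "norm (g j) = B + 1 + real j" for j
    using B v by (simp add: g_def)
  have gF: "1 \<le> norm (p - g j)" if "p \<in> F" for p j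
    using B(1)[OF that] g[of j] norm_triangle_ineq2[of "g j" p] by (simp add: norm_minus_commute)
  have gg: "1 \<le> norm (g i - g j)" if "i \<noteq> j" for i j
  proof -
    have "norm (g i - g j) = \<bar>real i - real j\<bar>"
      using v by (simp add: g_def flip: scaleR_diff_left)
    then show ?thesis using that by linarith
  qed
  have gg': "1 \<le> norm (g i - g j)" if "g i \<noteq> g j" for i j
    using gg[of i j] that by auto
  have injg: "inj_on g {..<N}"
  proof (rule inj_onI, rule ccontr)
    fix i j assume "g i = g j" "i \<noteq> j"
    then show False using gg[of i j] by simp
  qed
  define P where "P = F \<union> g ` {..<N}"
  have disj: "F \<inter> g ` {..<N} = {}"
  proof -
    have "g j \<notin> F" for j using gF[of "g j" j] by auto
    then show ?thesis by blast
  qed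
  have P: "finite P" "F \<subseteq> P" "card P = card F + N"
    using assms disj injg by (auto simp: P_def card_Un_disjoint card_image)
  let ?V = "\<lambda>Q. {(p, q). p \<in> Q \<and> q \<in> Q \<and> p \<noteq> q}"
  have fin: "finite (?V P)" "?V F \<subseteq> ?V P"
    using P by (auto intro: finite_subset[of _ "P \<times> P"])
  have "(\<Sum>(p, q) \<in> ?V P. norm (p - q) powr (- s))
      = (\<Sum>(p, q) \<in> ?V F. norm (p - q) powr (- s)) + (\<Sum>(p, q) \<in> ?V P - ?V F. norm (p - q) powr (- s))"
    using sum.subset_diff[OF fin(2,1)] by (simp add: add.commute)
  also have "(\<Sum>(p, q) \<in> ?V P - ?V F. norm (p - q) powr (- s)) \<le> (\<Sum>(p, q) \<in> ?V P - ?V F. 1)"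
  proof (rule sum_mono, clarsimp simp: P_def)
    fix p q assume pq: "p \<noteq> q" "p \<in> F \<longrightarrow> q \<notin> F" "p \<in> F \<or> p \<in> g ` {..<N}" "q \<in> F \<or> q \<in> g ` {..<N}"
    have "1 \<le> norm (p - q)"
      using pq gF gg' by (auto simp: norm_minus_commute)
    then have "norm (p - q) powr (- s) \<le> 1 powr (- s)"
      using assms by (intro powr_mono2') auto
    then show "norm (p - q) powr (- s) \<le> 1" by simp
  qed
  also have "\<dots> \<le> (real (card P))\<^sup>2"
  proof -
    have "card (?V P - ?V F) \<le> card (P \<times> P)"
      using P by (intro card_mono) auto
    then have "card (?V P - ?V F) \<le> (card P)\<^sup>2"
      by (simp add: card_cartesian_product power2_eq_square)
    then show ?thesis
      by (simp add: case_prod_unfold flip: of_nat_power)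
  qed
  finally show ?thesis using that P by simp
qed

lemma powr_dominated_by_power:
  fixes b c p :: real
  assumes "b > 1"
  shows "\<exists>L::nat. c * (real L + 1) powr p < b ^ L"
proof -
  have "(\<lambda>L::nat. c * (real L + 1) powr p / b ^ L) \<longlonglongrightarrow> 0"
    using assms by real_asymp
  then have "\<forall>\<^sub>F L in sequentially. c * (real L + 1) powr p / b ^ L < 1"
    by (rule order_tendstoD(2)) simp
  then obtain L where "c * (real L + 1) powr p / b ^ L < 1"
    using eventually_happens by fastforce
  then have "c * (real L + 1) powr p < b ^ L"
    using assms by (simp add: divide_less_eq)
  then show ?thesis ..
qed

text \<open>Padding level \<open>L\<close> to about \<open>sqrt W\<close> points, where
  \<open>W\<close> bounds its energy sum, gives bounded energy. Then \<open>n\<close> is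
  \<open>X powr (a / 2)\<close> up to a polynomial in \<open>L\<close>, while \<open>X\<close>
  points lie on the dust, so any exponent below \<open>2 / a\<close> fails for large
  \<open>L\<close>.\<close>

lemma cantor_dust_sharp:
  fixes k s \<beta> A :: real
  assumes k: "0 < k" "k \<le> real CARD('d)" and r: "r = 2 powr (- real CARD('d) / k)" and s: "k < s"
    and \<beta>: "\<beta> < 2 / (1 + s / k)"
  shows "\<exists>(n::nat) (P :: (real ^ 'd::finite) set).
    finite P \<and> card P = n \<and> s_energy s P \<le> 2 \<and> A * real n powr \<beta> < real (card (P \<inter> cantor_dust r))"
proof -
  have "0 < s" using k s by simp
  define a where "a = 1 + s / k"
  have a: "a > 2" using s k by (simp add: a_def)
  \<comment> \<open>A nonnegative exponent keeps \<open>powr\<close> monotone in the base; the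
    switch is harmless because \<open>n \<ge> 1\<close>.\<close>
  define \<beta>' where "\<beta>' = max \<beta> 0"
  define \<gamma> where "\<gamma> = \<beta>' * a / 2"
  have \<gamma>: "\<gamma> < 1" "0 \<le> \<beta>'"
    using \<beta> a by (auto simp: \<gamma>_def \<beta>'_def field_simps max_def simp flip: a_def)
  note r01 = dust_ratio_bounds[OF k r]
  \<comment> \<open>\<open>b ^ L\<close> is \<open>X powr (1 - \<gamma>)\<close>, the slack that
    must beat the polynomial and the constant \<open>A\<close>.\<close>
  define b where "b = 2 powr (real CARD('d) * (1 - \<gamma>))"
  have "b > 1" using \<gamma> by (simp add: b_def)
  then obtain L :: nat where L: "\<bar>A\<bar> * 3 powr \<beta>' * (real L + 1) powr ((2 * s + 1) * (\<beta>' / 2)) < b ^ L"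
    using powr_dominated_by_power by blast
  define X :: real where "X = 2 ^ (L * CARD('d))"
  have X: "X \<ge> 1" by (simp add: X_def)
  define W where "W = (real L + 1) powr (2 * s + 1) * X powr a"
  have "1 * X powr 2 \<le> W"
    unfolding W_def using X a s k by (intro mult_mono powr_mono ge_one_powr_ge_zero) auto
  then have "X\<^sup>2 \<le> W" using X by simp
  then have W: "X \<le> sqrt W" by (rule real_le_rsqrt)
  define N where "N = nat \<lceil>sqrt W\<rceil>"
  obtain P :: "(real ^ 'd) set" where P: "finite P" "cantor_level r L \<subseteq> P"
    "card P = card (cantor_level r L :: (real ^ 'd) set) + N"
    and S: "(\<Sum>(p, q) \<in> {(p, q). p \<in> P \<and> q \<in> P \<and> p \<noteq> q}. norm (p - q) powr (- s))
      \<le> (\<Sum>(p, q) \<in> {(p, q). p \<in> cantor_level r L \<and> q \<in> cantor_level r L \<and> p \<noteq> q}.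
          norm (p - q :: real ^ 'd) powr (- s)) + (real (card P))\<^sup>2"
    by (rule add_distant_points[OF finite_cantor_level \<open>0 < s\<close>, where N = N])
  have cX: "real (card (cantor_level r L :: (real ^ 'd) set)) = X"
    by (simp add: X_def card_cantor_level[OF r01])
  have n: "real (card P) = X + real N"
    using P(3) cX by simp
  \<comment> \<open>The factor 3 covers the level itself, the padding and the rounding up, each at
    most \<open>sqrt W\<close>.\<close>
  have n2: "sqrt W \<le> real (card P)" "real (card P) \<le> 3 * sqrt W" "real (card P) \<ge> 1"
    using n X W unfolding N_def by linarith+
  have "W \<le> (real (card P))\<^sup>2"
    using n2(1) sqrt_le_D by blast
  moreover have "(\<Sum>(p, q) \<in> {(p, q). p \<in> P \<and> q \<in> P \<and> p \<noteq> q}. norm (p - q) powr (- s)) \<le> W + (real (card P))\<^sup>2"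
    using S cantor_level_energy_sum_le[OF k r s, of L] by (simp add: W_def X_def a_def)
  ultimately have "s_energy s P \<le> 2"
    unfolding s_energy_def using n2(3) by (simp add: divide_le_eq)
  moreover have "A * real (card P) powr \<beta> < real (card (P \<inter> cantor_dust r))"
  proof -
    have "A * real (card P) powr \<beta> \<le> \<bar>A\<bar> * real (card P) powr \<beta>'"
      using n2(3) by (intro mult_mono powr_mono) (auto simp: \<beta>'_def)
    also have "\<dots> \<le> \<bar>A\<bar> * (3 * sqrt W) powr \<beta>'"
      using n2 \<gamma> by (intro mult_left_mono powr_mono2) auto
    also have "(3 * sqrt W) powr \<beta>' = 3 powr \<beta>' * W powr (\<beta>' / 2)"
      using powr_half_sqrt[of W] by (simp add: powr_mult powr_powr W_def flip: powr_half_sqrt)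
    also have "W powr (\<beta>' / 2) = (real L + 1) powr ((2 * s + 1) * (\<beta>' / 2)) * X powr \<gamma>"
      by (simp add: W_def powr_mult powr_powr \<gamma>_def mult_ac)
    also have "\<bar>A\<bar> * (3 powr \<beta>' * ((real L + 1) powr ((2 * s + 1) * (\<beta>' / 2)) * X powr \<gamma>))
        = (\<bar>A\<bar> * 3 powr \<beta>' * (real L + 1) powr ((2 * s + 1) * (\<beta>' / 2))) * X powr \<gamma>"
      by simp
    also have "\<dots> < b ^ L * X powr \<gamma>"
      using L X by (intro mult_strict_right_mono) auto
    also have "b ^ L = X powr (1 - \<gamma>)"
      unfolding b_def X_def by (simp add: powr_powr flip: powr_realpow) (simp add: mult_ac)
    also have "X powr (1 - \<gamma>) * X powr \<gamma> = X"
      using X by (simp flip: powr_add)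
    also have "X \<le> real (card (P \<inter> cantor_dust r))"
    proof -
      have "cantor_level r L \<subseteq> cantor_dust r"
        unfolding cantor_dust_def by (rule subset_trans[OF _ closure_subset]) blast
      then have "cantor_level r L \<subseteq> P \<inter> cantor_dust r"
        using P(2) by simp
      then have "card (cantor_level r L :: (real ^ 'd) set) \<le> card (P \<inter> cantor_dust r)"
        using P(1) by (intro card_mono) auto
      then show ?thesis unfolding cX[symmetric] by simp
    qed
    finally show ?thesis .
  qed
  ultimately show ?thesis using P(1) by blast
qed

theorem theorem4:
  assumes "2 \<le> CARD('d::finite)"
  shows
    "(\<forall>(E :: (real ^ 'd) set) (k::real) (C::real) (s::real) (P :: (real ^ 'd) set) (n::nat).
        compact E \<longrightarrow> 0 < k \<longrightarrow> 0 \<le> C \<longrightarrow>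
        (\<forall>\<delta>>0. real (covering_number E \<delta>) \<le> max (C * \<delta> powr (- k)) 1) \<longrightarrow>
        finite P \<longrightarrow> card P = n \<longrightarrow> k < s \<longrightarrow>
        real (card (P \<inter> E))
          \<le> (1 + (2 powr k * C) powr (s / k) * (s / k - 1) * s_energy s P) powr (1 / (s / k + 1))
            * real n powr (2 / (s / k + 1)))
     \<and>
     (\<forall>(k::real) (s::real). 0 < k \<longrightarrow> k \<le> real CARD('d) \<longrightarrow> k < s \<longrightarrow>
        (\<exists>E :: (real ^ 'd) set.
           compact E \<and>
           (\<exists>C\<ge>0. \<forall>\<delta>>0. real (covering_number E \<delta>) \<le> max (C * \<delta> powr (- k)) 1) \<and>
           (\<exists>M::real. \<forall>\<beta> < 2 / (1 + s / k). \<forall>A::real.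
              \<exists>(n::nat) (P :: (real ^ 'd) set).
                finite P \<and> card P = n \<and> s_energy s P \<le> M \<and>
                A * real n powr \<beta> < real (card (P \<inter> E)))))"
proof (intro conjI allI impI)
  fix E :: "(real ^ 'd) set" and k C s :: real and P :: "(real ^ 'd) set" and n :: nat
  assume "compact E" "0 < k" "0 \<le> C"
    "\<forall>\<delta>>0. real (covering_number E \<delta>) \<le> max (C * \<delta> powr (- k)) 1"
    "finite P" "card P = n" "k < s"
  then show "real (card (P \<inter> E))
      \<le> (1 + (2 powr k * C) powr (s / k) * (s / k - 1) * s_energy s P) powr (1 / (s / k + 1))
        * real n powr (2 / (s / k + 1))"
    by (intro card_inter_le_energy) auto
next
  fix k s :: real
  assume k: "0 < k" "k \<le> real CARD('d)" and s: "k < s"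
  define r where "r = 2 powr (- real CARD('d) / k)"
  let ?E = "cantor_dust r :: (real ^ 'd) set"
  show "\<exists>E :: (real ^ 'd) set.
           compact E \<and>
           (\<exists>C\<ge>0. \<forall>\<delta>>0. real (covering_number E \<delta>) \<le> max (C * \<delta> powr (- k)) 1) \<and>
           (\<exists>M::real. \<forall>\<beta> < 2 / (1 + s / k). \<forall>A::real.
              \<exists>(n::nat) (P :: (real ^ 'd) set).
                finite P \<and> card P = n \<and> s_energy s P \<le> M \<and>
                A * real n powr \<beta> < real (card (P \<inter> E)))"
  proof (rule exI[of _ ?E], intro conjI)
    show "compact ?E"
      by (rule compact_cantor_dust[OF dust_ratio_bounds[OF k r_def]])
    show "\<exists>C\<ge>0. \<forall>\<delta>>0. real (covering_number ?E \<delta>) \<le> max (C * \<delta> powr (- k)) 1"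
      using covering_number_cantor_dust[OF k r_def]
      by (intro exI[of _ "2 ^ CARD('d) * (2 * real CARD('d)) powr k"]) auto
    \<comment> \<open>\<open>M = 2\<close> serves all \<open>\<beta>\<close> and \<open>A\<close>.
      With the energy bounded, the first factor of the upper bound stays bounded, so only the
      exponent of \<open>n\<close> is being tested.\<close>
    show "\<exists>M::real. \<forall>\<beta> < 2 / (1 + s / k). \<forall>A::real.
        \<exists>(n::nat) (P :: (real ^ 'd) set).
          finite P \<and> card P = n \<and> s_energy s P \<le> M \<and> A * real n powr \<beta> < real (card (P \<inter> ?E))"
      using cantor_dust_sharp[OF k r_def s] by blast
  qed
qed

end
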